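(* Let $(M,\le_m)$ and $(L,\le_l)$ be partially ordered sets, and let $\boxminus: L\times L\to L$, $\boxplus: 2^L\to L$ and $\circledcirc: L\to L$ be operations satisfying the following axioms: (A1) for every $S\subseteq M$ there is $\breve S\subseteq S$ such that for every $s\in S$ there is $\breve s\in\breve S$ with $\breve s\le_m s$, and no two elements $\breve s,\breve s'\in\breve S$ satisfy $\breve s<_m\breve s'$; (A2) for all $L'\subseteq L$ and all $x\in L'$ we have $x\le_l\boxplus(L')$, and for all $L'\subseteq L''\subseteq L$ we have $\boxplus(L')\le_l\boxplus(L'')$; (A3) for all $l,l'\in L$: $\boxminus(l,\circledcirc(l))=l$, and $l\le_l l'$ implies $\circledcirc(l)\le_l\circledcirc(l')$; (A4) for all $l,l'\in L$ with $l\le_l l'$ there exists $l''\in L$ with $\boxminus(l',l'')=l$ and $\circledcirc(l')\le_l l''$. Suppose moreover that every strictly increasing chain in $(M,\le_m)$ has length at most $D$, for some integer $D\ge 0$. Then for every map $\psi:M\to L$ there exist an integer $k$ with $0\le k\le D$ and monotonic maps $\varphi_1,\dots,\varphi_{k+1}:M\to L$ such that for all $x\in M$, $$\psi(x)=\boxminus\big(\varphi_1(x),\boxminus(\varphi_2(x),\boxminus(\dots\boxminus(\varphi_k(x),\varphi_{k+1}(x))\dots))\big),$$ i.e. $\psi$ is represented by a nested expression of monotonic maps in which the operation $\boxminus$ occurs at most $D$ times.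
   Context: A map $\varphi:(M,\le_m)\to(L,\le_l)$ is monotonic if $m\le_m m'$ implies $\varphi(m)\le_l\varphi(m')$. The length of a strictly increasing chain $x_0<_m x_1<_m\dots<_m x_r$ is $r$ (so a three-element chain has length $2$). $2^L$ denotes the set of all subsets of $L$. Operations on $L$ are applied to maps $M\to L$ pointwise. *)

theory Defs
  imports Main
begin

end

theory Submission
  imports Defs
begin

text \<open>
  Peel off one layer of minimal elements of \<open>M\<close> per use of \<open>\<boxminus>\<close>. Suppose \<open>R\<close> is a down-set such that
  \<open>\<psi> y \<le> \<psi> x\<close> whenever \<open>y \<in> R\<close> and \<open>y \<le> x\<close>, and let \<open>R'\<close> be \<open>R\<close> together with the minimal elements
  of \<open>M - R\<close>. The map \<open>\<phi>\<close> that equals \<open>\<psi>\<close> on \<open>R'\<close> and \<open>\<boxplus> {\<psi> y | y \<le> x}\<close> elsewhere is monotonic and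
  dominates \<open>\<psi>\<close>, so \<open>\<psi> = \<phi> \<boxminus> \<chi>\<close> for some \<open>\<chi>\<close> that is at least \<open>\<circledcirc> \<circ> \<phi>\<close>, with equality on
  \<open>R'\<close>. Hence \<open>\<chi>\<close> has the same property with respect to \<open>R'\<close>. After \<open>D\<close> steps the complement of
  the down-set is an antichain, which makes the remaining map monotonic.
\<close>

lemma peel_monotone_layer:
  fixes M R :: "'m::order set" and boxminus :: "'l::order \<Rightarrow> 'l \<Rightarrow> 'l"
    and boxplus :: "'l set \<Rightarrow> 'l" and \<psi> :: "'m \<Rightarrow> 'l"
  assumes boxplus_upper: "\<And>L' x. x \<in> L' \<Longrightarrow> x \<le> boxplus L'"
    and boxplus_mono: "\<And>L' L''. L' \<subseteq> L'' \<Longrightarrow> boxplus L' \<le> boxplus L''"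
    and cancel: "\<And>l. boxminus l (circ l) = l"
    and circ_mono: "\<And>l l'. l \<le> l' \<Longrightarrow> circ l \<le> circ l'"
    and solve: "\<And>l l'. l \<le> l' \<Longrightarrow> \<exists>l''. boxminus l' l'' = l \<and> circ l' \<le> l''"
    and down: "\<And>x y. x \<in> R \<Longrightarrow> y \<in> M \<Longrightarrow> y \<le> x \<Longrightarrow> y \<in> R"
    and low: "\<And>x y. y \<in> R \<Longrightarrow> x \<in> M \<Longrightarrow> y \<le> x \<Longrightarrow> \<psi> y \<le> \<psi> x"
    and R': "R' = R \<union> {x \<in> M - R. \<forall>y\<in>M. y < x \<longrightarrow> y \<in> R}"
  shows "\<exists>\<phi> \<chi>. mono_on M \<phi> \<and> (\<forall>x\<in>M. \<psi> x = boxminus (\<phi> x) (\<chi> x)) \<and>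
    (\<forall>y\<in>M \<inter> R'. \<forall>x\<in>M. y \<le> x \<longrightarrow> \<chi> y \<le> \<chi> x)"
proof -
  define \<phi> where "\<phi> x = (if x \<in> R' then \<psi> x else boxplus (\<psi> ` {y \<in> M. y \<le> x}))" for x
  \<comment> \<open>Anything strictly below an element of \<open>R'\<close> already lies in
    \<open>R\<close>, since the added layer consists of minimal elements of \<open>M - R\<close>. So
    \<open>low\<close> settles monotonicity inside \<open>R'\<close>.\<close>
  have down': "y \<in> R' \<and> (y = x \<or> y \<in> R)" if "x \<in> R'" "y \<in> M" "y \<le> x" for x y
    using that down[of x y] unfolding R' by (auto simp: le_less)
  have mono: "\<phi> y \<le> \<phi> x" if "y \<in> M" "x \<in> M" "y \<le> x" for x y
  proof (cases "x \<in> R'")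
    case True
    then have "y \<in> R'" "y = x \<or> y \<in> R" using down' that by blast+
    then show ?thesis using True that low[of y x] by (auto simp: \<phi>_def)
  next
    case False
    show ?thesis
    proof (cases "y \<in> R'")
      case True
      then show ?thesis using False that by (auto simp: \<phi>_def intro!: boxplus_upper)
    next
      case y: False
      have "{z \<in> M. z \<le> y} \<subseteq> {z \<in> M. z \<le> x}" using that(3) by force
      then show ?thesis using False y by (auto simp: \<phi>_def intro!: boxplus_mono image_mono)
    qed
  qed
  \<comment> \<open>On \<open>R'\<close>, \<open>cancel\<close> permits the exact value
    \<open>circ (\<phi> x)\<close>; elsewhere \<open>solve\<close> yields only a lower bound.
    Equality at the smaller point and the bound at the larger one suffice to compare values of
    \<open>\<chi>\<close> below.\<close>
  have "\<exists>l. boxminus (\<phi> x) l = \<psi> x \<and> circ (\<phi> x) \<le> l \<and> (x \<in> R' \<longrightarrow> l = circ (\<phi> x))"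
    if "x \<in> M" for x
  proof (cases "x \<in> R'")
    case True
    then show ?thesis using cancel by (auto simp: \<phi>_def)
  next
    case False
    then have "\<psi> x \<le> \<phi> x" using that by (auto simp: \<phi>_def intro: boxplus_upper)
    then show ?thesis using solve False by blast
  qed
  then obtain \<chi> where \<chi>: "\<And>x. x \<in> M \<Longrightarrow> boxminus (\<phi> x) (\<chi> x) = \<psi> x"
      "\<And>x. x \<in> M \<Longrightarrow> circ (\<phi> x) \<le> \<chi> x" "\<And>x. x \<in> M \<Longrightarrow> x \<in> R' \<Longrightarrow> \<chi> x = circ (\<phi> x)"
    by metis
  have "\<chi> y \<le> \<chi> x" if "y \<in> M \<inter> R'" "x \<in> M" "y \<le> x" for x y
  proof -
    have "\<chi> y = circ (\<phi> y)" using \<chi>(3) that by blast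
    also have "\<dots> \<le> circ (\<phi> x)" using circ_mono mono that by blast
    also have "\<dots> \<le> \<chi> x" using \<chi>(2) that by blast
    finally show ?thesis .
  qed
  moreover have "mono_on M \<phi>" using mono by (auto intro: mono_onI)
  ultimately show ?thesis using \<chi>(1) by metis
qed

text \<open>The induction needs a general down-set \<open>R\<close> on which \<open>\<psi>\<close>
  is already well behaved. Chains are measured outside \<open>R\<close>, so that peeling a layer
  lowers the bound by one while \<open>\<psi>\<close> is replaced by \<open>\<chi>\<close>.\<close>

lemma nested_monotone_representation:
  fixes M R :: "'m::order set" and boxminus :: "'l::order \<Rightarrow> 'l \<Rightarrow> 'l"
    and boxplus :: "'l set \<Rightarrow> 'l" and \<psi> :: "'m \<Rightarrow> 'l"
  assumes boxplus_upper: "\<And>L' x. x \<in> L' \<Longrightarrow> x \<le> boxplus L'"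
    and boxplus_mono: "\<And>L' L''. L' \<subseteq> L'' \<Longrightarrow> boxplus L' \<le> boxplus L''"
    and cancel: "\<And>l. boxminus l (circ l) = l"
    and circ_mono: "\<And>l l'. l \<le> l' \<Longrightarrow> circ l \<le> circ l'"
    and solve: "\<And>l l'. l \<le> l' \<Longrightarrow> \<exists>l''. boxminus l' l'' = l \<and> circ l' \<le> l''"
    and "R \<subseteq> M"
    and "\<And>x y. x \<in> R \<Longrightarrow> y \<in> M \<Longrightarrow> y \<le> x \<Longrightarrow> y \<in> R"
    and "\<And>x y. y \<in> R \<Longrightarrow> x \<in> M \<Longrightarrow> y \<le> x \<Longrightarrow> \<psi> y \<le> \<psi> x"
    and "\<And>(r::nat) x. \<forall>i\<le>r. x i \<in> M - R \<Longrightarrow> \<forall>i<r. x i < x (Suc i) \<Longrightarrow> r \<le> k"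
  shows "\<exists>\<phi> :: nat \<Rightarrow> 'm \<Rightarrow> 'l. (\<forall>i\<in>{1..k+1}. mono_on M (\<phi> i)) \<and>
    (\<forall>x\<in>M. \<psi> x = foldr boxminus (map (\<lambda>i. \<phi> i x) [1..<k+1]) (\<phi> (k+1) x))"
  using assms(6-9)
proof (induction k arbitrary: R \<psi>)
  case 0
  \<comment> \<open>A comparable pair would be a chain of length 1, against the bound 0.\<close>
  have antichain: "\<not> y < x" if "y \<in> M - R" "x \<in> M - R" for x y
  proof
    assume "y < x"
    then have "1 \<le> (0::nat)"
      using that by (intro 0(4)[of 1 "\<lambda>i. if i = 0 then y else x"]) auto
    then show False by simp
  qed
  \<comment> \<open>If \<open>y\<close> is in \<open>R\<close>, the hypothesis on \<open>R\<close>
    applies. Otherwise \<open>x\<close> is outside \<open>R\<close> too, because \<open>R\<close> is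
    a down-set, and the antichain property forces \<open>y = x\<close>.\<close>
  have "\<psi> y \<le> \<psi> x" if "y \<in> M" "x \<in> M" "y \<le> x" for x y
    using antichain[of y x] 0(2)[of x y] 0(3)[of y x] that by (auto simp: le_less)
  then have "mono_on M \<psi>" by (auto intro: mono_onI)
  then show ?case by (intro exI[of _ "\<lambda>_. \<psi>"]) simp
next
  case (Suc k)
  define R' where "R' = R \<union> {x \<in> M - R. \<forall>y\<in>M. y < x \<longrightarrow> y \<in> R}"
  have "\<exists>\<phi> \<chi>. mono_on M \<phi> \<and> (\<forall>x\<in>M. \<psi> x = boxminus (\<phi> x) (\<chi> x)) \<and>
    (\<forall>y\<in>M \<inter> R'. \<forall>x\<in>M. y \<le> x \<longrightarrow> \<chi> y \<le> \<chi> x)"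
    by (rule peel_monotone_layer[of boxplus boxminus circ R M \<psi> R'])
      (fact assms(1-5) Suc.prems(2,3) R'_def)+
  then obtain \<phi>\<^sub>1 \<chi> where \<phi>\<^sub>1: "mono_on M \<phi>\<^sub>1"
    and \<psi>: "\<forall>x\<in>M. \<psi> x = boxminus (\<phi>\<^sub>1 x) (\<chi> x)"
    and \<chi>: "\<forall>y\<in>M \<inter> R'. \<forall>x\<in>M. y \<le> x \<longrightarrow> \<chi> y \<le> \<chi> x"
    by (elim exE conjE)
  have R'M: "R' \<subseteq> M" using Suc.prems(1) by (auto simp: R'_def)
  have down': "y \<in> R'" if "x \<in> R'" "y \<in> M" "y \<le> x" for x y
    using that Suc.prems(2)[of x y] unfolding R'_def by (auto simp: le_less)
  have chains': "r \<le> k" if x: "\<forall>i\<le>r. x i \<in> M - R'" "\<forall>i<r. x i < x (Suc i)" for r and x :: "nat \<Rightarrow> 'm"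
  proof -
    have "x 0 \<in> M - R'" using x by blast
    \<comment> \<open>The start of a chain outside \<open>R'\<close> is not minimal in
      \<open>M - R\<close>, so the chain can be extended downwards by some \<open>y\<close> outside
      \<open>R\<close>.\<close>
    then obtain y where y: "y \<in> M - R" "y < x 0" by (auto simp: R'_def)
    have "Suc r \<le> Suc k"
    proof (rule Suc.prems(4)[of _ "case_nat y x"])
      show "\<forall>i\<le>Suc r. case_nat y x i \<in> M - R"
        using x(1) y(1) by (auto simp: R'_def split: nat.split)
      show "\<forall>i<Suc r. case_nat y x i < case_nat y x (Suc i)"
        using x(2) y(2) by (auto split: nat.split)
    qed
    then show ?thesis by simp
  qed
  have \<chi>': "\<chi> y \<le> \<chi> x" if "y \<in> R'" "x \<in> M" "y \<le> x" for x y
    using \<chi> R'M that by blast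
  have "\<exists>\<phi> :: nat \<Rightarrow> 'm \<Rightarrow> 'l. (\<forall>i\<in>{1..k+1}. mono_on M (\<phi> i)) \<and>
    (\<forall>x\<in>M. \<chi> x = foldr boxminus (map (\<lambda>i. \<phi> i x) [1..<k+1]) (\<phi> (k+1) x))"
    by (rule Suc.IH[of R']) (fact R'M down' \<chi>' chains')+
  then obtain \<phi> :: "nat \<Rightarrow> 'm \<Rightarrow> 'l" where \<phi>: "\<forall>i\<in>{1..k+1}. mono_on M (\<phi> i)"
    "\<forall>x\<in>M. \<chi> x = foldr boxminus (map (\<lambda>i. \<phi> i x) [1..<k+1]) (\<phi> (k+1) x)"
    by blast
  \<comment> \<open>The new outermost map takes index 1 and the maps from the induction hypothesis
    move up by one.\<close>
  define \<theta> where "\<theta> i = (if i = 1 then \<phi>\<^sub>1 else \<phi> (i - 1))" for i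
  have "mono_on M (\<theta> i)" if "i \<in> {1..Suc k+1}" for i
  proof (cases "i = 1")
    case False
    then have "i - 1 \<in> {1..k+1}" using that by auto
    then show ?thesis using \<phi>(1) False by (simp add: \<theta>_def)
  qed (simp add: \<theta>_def \<phi>\<^sub>1)
  moreover have "\<psi> x = foldr boxminus (map (\<lambda>i. \<theta> i x) [1..<Suc k+1]) (\<theta> (Suc k+1) x)"
    if "x \<in> M" for x
  proof -
    \<comment> \<open>The list is split at its head, so that \<open>foldr\<close> exposes the
      outermost \<open>boxminus\<close>; \<open>upt_Suc\<close> would split off the last index
      instead.\<close>
    have "[1..<Suc k+1] = 1 # map Suc [1..<k+1]"
      by (simp add: map_Suc_upt upt_conv_Cons del: upt_Suc)
    moreover have "map (\<lambda>i. \<theta> i x) (map Suc [1..<k+1]) = map (\<lambda>i. \<phi> i x) [1..<k+1]"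
      by (auto simp: \<theta>_def)
    moreover have "\<theta> 1 = \<phi>\<^sub>1" "\<theta> (Suc k+1) = \<phi> (k+1)" by (simp_all add: \<theta>_def)
    ultimately show ?thesis
      using \<psi> \<phi>(2) that by (simp del: upt_Suc map_map)
  qed
  ultimately show ?case by blast
qed

theorem theorem1:
  fixes M :: "'m::order set"
    and boxminus :: "'l::order \<Rightarrow> 'l \<Rightarrow> 'l"
    and boxplus :: "'l set \<Rightarrow> 'l"
    and circ :: "'l \<Rightarrow> 'l"
    and D :: nat
    and \<psi> :: "'m \<Rightarrow> 'l"
  assumes A1: "\<forall>S\<subseteq>M. \<exists>T\<subseteq>S. (\<forall>s\<in>S. \<exists>t\<in>T. t \<le> s) \<and> (\<forall>t\<in>T. \<forall>t'\<in>T. \<not> t < t')"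
    and A2_upper: "\<forall>L'. \<forall>x\<in>L'. x \<le> boxplus L'"
    and A2_mono: "\<forall>L' L''. L' \<subseteq> L'' \<longrightarrow> boxplus L' \<le> boxplus L''"
    and A3_cancel: "\<forall>l. boxminus l (circ l) = l"
    and A3_mono: "\<forall>l l'. l \<le> l' \<longrightarrow> circ l \<le> circ l'"
    and A4: "\<forall>l l'. l \<le> l' \<longrightarrow> (\<exists>l''. boxminus l' l'' = l \<and> circ l' \<le> l'')"
    and chains: "\<forall>(r::nat) (x::nat \<Rightarrow> 'm).
      (\<forall>i\<le>r. x i \<in> M) \<and> (\<forall>i<r. x i < x (Suc i)) \<longrightarrow> r \<le> D"
  shows "\<exists>k\<le>D. \<exists>\<phi> :: nat \<Rightarrow> 'm \<Rightarrow> 'l.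
    (\<forall>i\<in>{1..k+1}. mono_on M (\<phi> i)) \<and>
    (\<forall>x\<in>M. \<psi> x = foldr boxminus (map (\<lambda>i. \<phi> i x) [1..<k+1]) (\<phi> (k+1) x))"
proof -
  have "\<exists>\<phi> :: nat \<Rightarrow> 'm \<Rightarrow> 'l. (\<forall>i\<in>{1..D+1}. mono_on M (\<phi> i)) \<and>
    (\<forall>x\<in>M. \<psi> x = foldr boxminus (map (\<lambda>i. \<phi> i x) [1..<D+1]) (\<phi> (D+1) x))"
  \<comment> \<open>For the empty down-set the conditions on \<open>\<psi>\<close> are vacuous, and
    \<open>k = D\<close> always works.\<close>
  proof (rule nested_monotone_representation[where R = "{}" and boxplus = boxplus and circ = circ])
    show "r \<le> D" if "\<forall>i\<le>r. x i \<in> M - {}" "\<forall>i<r. x i < x (Suc i)" for r and x :: "nat \<Rightarrow> 'm"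
      using chains[rule_format, of r x] that by simp
  qed (use A2_upper A2_mono A3_cancel A3_mono A4 in simp_all)
  then show ?thesis by blast
qed

end
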